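(* Let $H$ and $K$ be two non-trivial finite groups. Then the coprime graph $\Gamma(H\times K)$ is a divisor graph if and only if one of the following holds: (a) $\pi(H)=\pi(K)=\{p,q\}$ for distinct primes $p$ and $q$; (b) $\pi(H)=\{p\}$, $\pi(K)\subseteq\{p,q,r\}$ and $qr\notin\pi_e(K)$, where $p,q,r$ are pairwise distinct primes.
   Context: For a finite group $G$, $\pi(G)$ is the set of prime divisors of $|G|$, and $\pi_e(G)$ is the set of orders of the non-identity elements of $G$. The coprime graph $\Gamma(G)$ is the simple undirected graph with vertex set $G$ in which two distinct vertices $x,y$ are adjacent if and only if $\gcd(o(x),o(y))=1$, where $o(x)$ is the order of $x$. A simple undirected graph $\Gamma$ is a divisor graph if there is an injection $\alpha$ from $V(\Gamma)$ to the set of positive integers such that distinct $x,y\in V(\Gamma)$ are adjacent if and only if $\alpha(x)\mid\alpha(y)$ or $\alpha(y)\mid\alpha(x)$.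
   Formalization: Condition (b) is allowed also with H and K exchanged; read literally the claim fails for H = S_3, K = C_2, where Γ(H×K) is a divisor graph but neither (a) nor (b) holds in that order. *)

theory Defs
  imports "HOL-Computational_Algebra.Primes" "HOL-Algebra.Multiplicative_Group" "Graph_Theory.Pair_Digraph"
begin

definition order_primes :: "('a, 'm) monoid_scheme \<Rightarrow> nat set" where
  "order_primes G = {p. prime p \<and> p dvd order G}"

definition element_orders :: "('a, 'm) monoid_scheme \<Rightarrow> nat set" where
  "element_orders G = group.ord G ` (carrier G - {\<one>\<^bsub>G\<^esub>})"

text \<open>A simple undirected graph is represented as a symmetric loop-free digraph
  (\<^locale>\<open>pair_bidirected_digraph\<close>): \<open>x\<close> and \<open>y\<close> are adjacent iff
  \<open>(x, y)\<close>, equivalently \<open>(y, x)\<close>, is an arc.\<close>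

definition coprime_graph :: "('a, 'm) monoid_scheme \<Rightarrow> 'a pair_pre_digraph" where
  "coprime_graph G =
    \<lparr> pverts = carrier G,
      parcs = {(x, y). x \<in> carrier G \<and> y \<in> carrier G \<and> x \<noteq> y \<and>
        gcd (group.ord G x) (group.ord G y) = 1} \<rparr>"

lemma coprime_graph_simple: "pair_bidirected_digraph (coprime_graph G)"
  unfolding coprime_graph_def
  by unfold_locales
    (auto simp: symmetric_def arcs_ends_def arc_to_ends_def with_proj_def sym_def gcd.commute)

definition divisor_graph :: "'a pair_pre_digraph \<Rightarrow> bool" where
  "divisor_graph \<Gamma> \<longleftrightarrow> pair_bidirected_digraph \<Gamma> \<and>
    (\<exists>\<alpha> :: 'a \<Rightarrow> nat. inj_on \<alpha> (pverts \<Gamma>) \<and> (\<forall>x\<in>pverts \<Gamma>. 0 < \<alpha> x) \<and>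
      (\<forall>x\<in>pverts \<Gamma>. \<forall>y\<in>pverts \<Gamma>. x \<noteq> y \<longrightarrow>
        ((x, y) \<in> parcs \<Gamma> \<longleftrightarrow> \<alpha> x dvd \<alpha> y \<or> \<alpha> y dvd \<alpha> x)))"

definition condition_a :: "('a, 'm) monoid_scheme \<Rightarrow> ('b, 'n) monoid_scheme \<Rightarrow> bool" where
  "condition_a H K \<longleftrightarrow>
    (\<exists>p q. prime p \<and> prime q \<and> p \<noteq> q \<and> order_primes H = {p, q} \<and> order_primes K = {p, q})"

text \<open>Condition (b) depends on the order of the two factors, whereas the divisor graph
  property of the coprime graph of \<open>H \<times> K\<close> does not: for the symmetric group of degree 3 as
  \<open>H\<close> and a cyclic group of order 2 as \<open>K\<close> the coprime graph is a divisor graph, and (b)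
  holds only with the factors exchanged. The two factors are therefore an unordered pair, and
  (b) must be allowed for either naming of them.\<close>

definition condition_b :: "('a, 'm) monoid_scheme \<Rightarrow> ('b, 'n) monoid_scheme \<Rightarrow> bool" where
  "condition_b H K \<longleftrightarrow>
    (\<exists>p q r. prime p \<and> prime q \<and> prime r \<and> p \<noteq> q \<and> p \<noteq> r \<and> q \<noteq> r \<and>
      order_primes H = {p} \<and> order_primes K \<subseteq> {p, q, r} \<and> q * r \<notin> element_orders K)"

end

theory Submission
  imports Defs "HOL-Algebra.Sylow"
begin

text \<open>Divisibility is a partial order, and conversely every finite strict order embeds in it
  (\<open>strict_order_embeds_in_divisibility\<close>). So a finite graph is a divisor graph if and only if its
  edges have a transitive orientation. In a coprime graph adjacency depends only on the sets of
  primes dividing the orders of the two elements: nontrivial elements are adjacent when these sets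
  are disjoint. The question is thus which families of prime sets have a transitively orientable
  disjointness graph, and for \<open>H \<times> K\<close> the sets that occur are the unions of one from \<open>H\<close> and one
  from \<open>K\<close>.

  If \<open>p\<close>, \<open>q\<close>, \<open>r\<close> are the only primes and each element whose order is divisible by \<open>q * r\<close> also
  has order divisible by \<open>p\<close>, orient the edges from \<open>r\<close> through \<open>p\<close> to \<open>q\<close>: let \<open>x\<close> precede a
  coprime \<open>y\<close> when \<open>r\<close> divides the order of \<open>x\<close> or \<open>q\<close> divides that of \<open>y\<close>, and let the
  identity precede everything. This is transitive (\<open>divisor_graph_coprime_graphI\<close>) and covers both
  conditions; with two primes only, one of them is listed twice.

  For the converse, a transitive orientation is rigid: a product of two primes that occurs as an
  element order forces every edge from a third prime to the two factors to point the same way.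
  Three primes form a triangle, and forcing at all three of them, directly or by way of a fourth
  prime, is contradictory (\<open>divisor_graph_linked_triple_free\<close>). In \<open>H \<times> K\<close> every product of a prime
  of \<open>H\<close> and a different prime of \<open>K\<close> occurs. If both factors have at least two primes, these
  products force at each vertex of any triangle, so there are only two primes altogether. If one
  factor has the single prime \<open>p\<close>, three primes of the other factor distinct from \<open>p\<close> are forced
  through \<open>p\<close>, and two such primes \<open>q\<close>, \<open>r\<close> form with \<open>p\<close> a forced triangle as soon as \<open>q * r\<close>
  is an element order.\<close>


section \<open>Element orders\<close>

text \<open>A nontrivial element of the subgroup of order \<open>p\<close> given by Sylow's theorem for the first
  power of \<open>p\<close>.\<close>

lemma (in group) cauchy_element_of_prime_order:
  assumes fin: "finite (carrier G)" and p: "prime p" and dvd: "p dvd order G"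
  shows "\<exists>x\<in>carrier G. ord x = p"
proof -
  from dvd obtain m where "order G = p ^ 1 * m"
    by (auto elim: dvdE)
  with p fin obtain S where S: "subgroup S G" "card S = p"
    using sylow_thm[OF p is_group] by (metis power_one_right)
  interpret S: group "G\<lparr>carrier := S\<rparr>"
    using S(1) by (rule subgroup_imp_group)
  have "S \<noteq> {\<one>}"
    using S(2) p by auto
  then obtain x where x: "x \<in> S" "x \<noteq> \<one>"
    using subgroup.one_closed[OF S(1)] by blast
  then have xG: "x \<in> carrier G"
    using S(1) subgroup.mem_carrier by metis
  have "x [^]\<^bsub>G\<lparr>carrier := S\<rparr>\<^esub> p = \<one>"
    using S.pow_order_eq_1[of x] x(1) S(2) by (simp add: order_def)
  then have "x [^] p = \<one>"
    by (simp add: nat_pow_def)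
  then have "ord x dvd p"
    using pow_eq_id[OF xG] by simp
  with p x(2) xG have "ord x = p"
    using ord_eq_1[OF xG] prime_nat_iff by metis
  with xG show ?thesis ..
qed

lemma nat_pow_DirProd:
  "(x, y) [^]\<^bsub>H \<times>\<times> K\<^esub> (n::nat) = (x [^]\<^bsub>H\<^esub> n, y [^]\<^bsub>K\<^esub> n)"
  by (induction n) (simp_all add: nat_pow_def)

lemma ord_DirProd:
  assumes "group H" "group K" and x: "x \<in> carrier H" and y: "y \<in> carrier K"
  shows "group.ord (H \<times>\<times> K) (x, y) = lcm (group.ord H x) (group.ord K y)"
proof -
  interpret H: group H by fact
  interpret K: group K by fact
  interpret HK: group "H \<times>\<times> K"
    using assms(1,2) by (rule DirProd_group)
  have xy: "(x, y) \<in> carrier (H \<times>\<times> K)"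
    using x y by simp
  show ?thesis
  proof (rule HK.ord_unique[OF xy, THEN iffD2], intro allI)
    fix n
    show "((x, y) [^]\<^bsub>H \<times>\<times> K\<^esub> n = \<one>\<^bsub>H \<times>\<times> K\<^esub>) =
        (lcm (H.ord x) (K.ord y) dvd n)"
      by (simp add: nat_pow_DirProd H.pow_eq_id[OF x] K.pow_eq_id[OF y])
  qed
qed

lemma (in group) element_orders_iff:
  "n \<in> element_orders G \<longleftrightarrow> n \<noteq> 1 \<and> (\<exists>x\<in>carrier G. ord x = n)"
  unfolding element_orders_def using ord_eq_1 by auto

lemma (in group) element_orders_divisor:
  assumes fin: "finite (carrier G)" and x: "x \<in> carrier G" and d: "d dvd ord x" "d \<noteq> 1"
  shows "d \<in> element_orders G"
proof -
  have pos: "ord x > 0"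
    using ord_ge_1[OF fin x] by simp
  obtain e where e: "ord x = d * e"
    using d(1) ..
  have "ord (x [^] e) = d"
    using ord_pow[of x e] x e pos by simp
  then show ?thesis
    using d(2) x by (auto simp: element_orders_iff)
qed

lemma (in group) prime_dvd_ord_order_primes:
  "x \<in> carrier G \<Longrightarrow> prime s \<Longrightarrow> s dvd ord x \<Longrightarrow> s \<in> order_primes G"
  unfolding order_primes_def using ord_dvd_group_order dvd_trans by blast

lemma (in group) order_primes_subset_element_orders:
  "finite (carrier G) \<Longrightarrow> order_primes G \<subseteq> element_orders G"
  unfolding order_primes_def element_orders_iff[abs_def]
  using cauchy_element_of_prime_order by (auto simp: element_orders_iff)

lemma (in group) order_primes_nonempty:
  assumes fin: "finite (carrier G)" and "carrier G \<noteq> {\<one>}"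
  shows "order_primes G \<noteq> {}"
proof -
  obtain x where "x \<in> carrier G" "x \<noteq> \<one>"
    using assms(2) by blast
  then have "ord x \<noteq> 1"
    using ord_eq_1 by simp
  then obtain p where "prime p" "p dvd ord x"
    using prime_factor_nat by blast
  with \<open>x \<in> carrier G\<close> show ?thesis
    using prime_dvd_ord_order_primes by blast
qed

lemma element_orders_DirProd_mult:
  assumes "group H" "group K" and m: "m \<in> element_orders H" and n: "n \<in> element_orders K"
    and "coprime m n"
  shows "m * n \<in> element_orders (H \<times>\<times> K)"
proof -
  interpret H: group H by fact
  interpret K: group K by fact
  interpret HK: group "H \<times>\<times> K"
    using assms(1,2) by (rule DirProd_group)
  obtain x y where "x \<in> carrier H" "H.ord x = m" "y \<in> carrier K" "K.ord y = n"
    using m n by (auto simp: H.element_orders_iff K.element_orders_iff)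
  then have "HK.ord (x, y) = m * n" "(x, y) \<in> carrier (H \<times>\<times> K)"
    using assms by (auto simp: ord_DirProd lcm_coprime)
  moreover have "m * n \<noteq> 1"
    using m by (simp add: H.element_orders_iff)
  ultimately show ?thesis
    by (auto simp: HK.element_orders_iff)
qed

lemma element_orders_subset_DirProd:
  assumes "group H" "group K"
  shows "element_orders H \<subseteq> element_orders (H \<times>\<times> K)"
    and "element_orders K \<subseteq> element_orders (H \<times>\<times> K)"
proof -
  interpret H: group H by fact
  interpret K: group K by fact
  interpret HK: group "H \<times>\<times> K"
    using assms by (rule DirProd_group)
  have "HK.ord (x, \<one>\<^bsub>K\<^esub>) = H.ord x" if "x \<in> carrier H" for x
    using that assms by (simp add: ord_DirProd)
  then show "element_orders H \<subseteq> element_orders (H \<times>\<times> K)"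
    by (force simp: H.element_orders_iff HK.element_orders_iff)
  have "HK.ord (\<one>\<^bsub>H\<^esub>, y) = K.ord y" if "y \<in> carrier K" for y
    using that assms by (simp add: ord_DirProd)
  then show "element_orders K \<subseteq> element_orders (H \<times>\<times> K)"
    by (force simp: K.element_orders_iff HK.element_orders_iff)
qed


section \<open>Divisor graphs as comparability graphs\<close>

text \<open>Give the elements distinct primes and label each element by the product of the primes at or
  below it. Its own prime divides the labels of exactly the elements at or above it, so
  divisibility of labels recovers the order.\<close>

lemma strict_order_embeds_in_divisibility:
  fixes less :: "'a \<Rightarrow> 'a \<Rightarrow> bool"
  assumes fin: "finite V"
    and irrefl: "\<And>x. x \<in> V \<Longrightarrow> \<not> less x x"
    and trans: "\<And>x y z. x \<in> V \<Longrightarrow> y \<in> V \<Longrightarrow> z \<in> V \<Longrightarrow> less x y \<Longrightarrow> less y z \<Longrightarrow> less x z"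
  obtains \<alpha> :: "'a \<Rightarrow> nat" where "inj_on \<alpha> V" "\<And>x. 0 < \<alpha> x"
    "\<And>x y. x \<in> V \<Longrightarrow> y \<in> V \<Longrightarrow> \<alpha> x dvd \<alpha> y \<longleftrightarrow> x = y \<or> less x y"
proof -
  obtain T where T: "finite T" "card T = card V" "T \<subseteq> {p::nat. prime p}"
    using infinite_arbitrarily_large[OF primes_infinite] by metis
  then obtain g where "bij_betw g V T"
    using fin finite_same_card_bij by metis
  with T have inj: "inj_on g V" and pr: "\<And>x. x \<in> V \<Longrightarrow> prime (g x)"
    by (auto simp: bij_betw_def)
  define down where "down x = {z \<in> V. z = x \<or> less z x}" for x
  have findown: "finite (down x)" and downV: "down x \<subseteq> V" for x
    using fin by (auto simp: down_def)
  define \<alpha> where "\<alpha> x = (\<Prod>z\<in>down x. g z)" for x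
  have iff: "\<alpha> x dvd \<alpha> y \<longleftrightarrow> x = y \<or> less x y" if xy: "x \<in> V" "y \<in> V" for x y
  proof
    assume "x = y \<or> less x y"
    then have "down x \<subseteq> down y"
      unfolding down_def using trans[OF _ xy] by blast
    then show "\<alpha> x dvd \<alpha> y"
      unfolding \<alpha>_def using findown by (intro prod_dvd_prod_subset)
  next
    assume "\<alpha> x dvd \<alpha> y"
    moreover have "g x dvd \<alpha> x"
      unfolding \<alpha>_def using xy by (intro dvd_prodI findown) (simp add: down_def)
    ultimately have "g x dvd (\<Prod>z\<in>down y. g z)"
      using \<alpha>_def dvd_trans by metis
    then obtain z where z: "z \<in> down y" "g x dvd g z"
      using pr[OF xy(1)] by (auto simp: prime_dvd_prod_iff findown)
    then have "z \<in> V"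
      using downV by blast
    with z(2) have "g x = g z"
      using primes_dvd_imp_eq[OF pr pr] xy(1) by simp
    then have "x = z"
      using inj_onD[OF inj] xy(1) \<open>z \<in> V\<close> by simp
    with z(1) show "x = y \<or> less x y"
      by (simp add: down_def)
  qed
  have "inj_on \<alpha> V"
  proof (rule inj_onI, rule ccontr)
    fix x y
    assume *: "x \<in> V" "y \<in> V" "\<alpha> x = \<alpha> y" "x \<noteq> y"
    then have "less x y" "less y x"
      using iff[of x y] iff[of y x] by auto
    with * show False
      using trans[of x y x] irrefl by blast
  qed
  moreover have "0 < \<alpha> x" for x
    unfolding \<alpha>_def using pr prime_gt_0_nat by (intro prod_pos) (auto simp: down_def)
  ultimately show ?thesis
    using iff by (rule that)
qed

text \<open>Transitivity of the order below: a chain of nontrivial elements \<open>x\<close>, \<open>y\<close>, \<open>z\<close> has neighbours of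
  coprime orders, and the hypothesis on \<open>q\<close> and \<open>r\<close> leaves only the case that the orders are
  powers of \<open>r\<close>, \<open>p\<close> and \<open>q\<close> respectively. Comparability of adjacent nontrivial
  elements: one of the two coprime orders is prime to \<open>p\<close>, hence divisible by \<open>q\<close> or \<open>r\<close>.\<close>

lemma (in group) divisor_graph_coprime_graphI:
  assumes fin: "finite (carrier G)"
    and pqr: "prime p" "prime q" "prime r"
    and primes: "\<And>x s. x \<in> carrier G \<Longrightarrow> prime s \<Longrightarrow> s dvd ord x \<Longrightarrow> s \<in> {p, q, r}"
    and qr: "\<And>x. x \<in> carrier G \<Longrightarrow> q dvd ord x \<Longrightarrow> r dvd ord x \<Longrightarrow> p dvd ord x"
  shows "divisor_graph (coprime_graph G)"
proof -
  define less where "less x y \<longleftrightarrow> x \<noteq> y \<and> coprime (ord x) (ord y) \<and>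
    (x = \<one> \<or> y \<noteq> \<one> \<and> (r dvd ord x \<or> q dvd ord y))" for x y
  have not_both: "\<not> (s dvd ord x \<and> s dvd ord y)" if "coprime (ord x) (ord y)" "prime s" for s x y
    using that coprime_common_divisor_nat not_prime_1 by metis
  have trivial: "x = \<one>" if "x \<in> carrier G" "\<not> p dvd ord x" "\<not> q dvd ord x" "\<not> r dvd ord x" for x
    using that primes[OF that(1)] prime_factor_nat[of "ord x"] ord_eq_1[OF that(1)] by blast
  have trans: "less x z"
    if V: "x \<in> carrier G" "y \<in> carrier G" "z \<in> carrier G" and xy: "less x y" and yz: "less y z" for x y z
  proof (cases "x = \<one>")
    case True
    with xy yz V show ?thesis
      by (auto simp: less_def)
  next
    case False
    from False xy have y: "y \<noteq> \<one>" and cxy: "coprime (ord x) (ord y)" and xy': "r dvd ord x \<or> q dvd ord y"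
      by (auto simp: less_def)
    from y yz have z: "z \<noteq> \<one>" and cyz: "coprime (ord y) (ord z)" and yz': "r dvd ord y \<or> q dvd ord z"
      by (auto simp: less_def)
    note nxy = not_both[OF cxy] and nyz = not_both[OF cyz]
    \<comment> \<open>Otherwise \<open>q\<close> divides the order of \<open>y\<close>, hence so do \<open>r\<close> and then \<open>p\<close>, leaving no prime for \<open>x\<close>.\<close>
    have rx: "r dvd ord x"
    proof (rule ccontr)
      assume "\<not> r dvd ord x"
      with xy' have "q dvd ord y" by simp
      with yz' nyz pqr have "r dvd ord y" by blast
      with \<open>q dvd ord y\<close> qr V have "p dvd ord y" by blast
      with \<open>q dvd ord y\<close> \<open>r dvd ord y\<close> nxy pqr False trivial V show False by metis
    qed
    with nxy pqr yz' have qz: "q dvd ord z" by blast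
    then have "\<not> q dvd ord y" "\<not> r dvd ord y"
      using rx nxy nyz pqr by blast+
    with y trivial V have "p dvd ord y" by blast
    then have px: "\<not> p dvd ord x" and pz: "\<not> p dvd ord z"
      using nxy nyz pqr by blast+
    have "coprime (ord x) (ord z)"
    proof (rule ccontr)
      assume "\<not> coprime (ord x) (ord z)"
      then obtain s where "prime s" "s dvd ord x" "s dvd ord z"
        using prime_factor_nat[of "gcd (ord x) (ord z)"] by (auto simp: coprime_iff_gcd_eq_1)
      with primes V px pz have "s \<in> {q, r}" by blast
      with \<open>s dvd ord x\<close> \<open>s dvd ord z\<close> rx qz qr V px pz show False by blast
    qed
    moreover have "x \<noteq> z"
      using rx qz qr V px by blast
    ultimately show ?thesis
      using rx z by (simp add: less_def)
  qed
  have comparable: "x \<noteq> y \<and> coprime (ord x) (ord y) \<longleftrightarrow> less x y \<or> less y x"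
    if V: "x \<in> carrier G" "y \<in> carrier G" for x y
  proof
    assume xy: "x \<noteq> y \<and> coprime (ord x) (ord y)"
    then have "x \<noteq> \<one> \<Longrightarrow> y \<noteq> \<one> \<Longrightarrow> r dvd ord x \<or> q dvd ord y \<or> r dvd ord y \<or> q dvd ord x"
      using trivial V not_both[of x y p] pqr by blast
    with xy show "less x y \<or> less y x"
      by (auto simp: less_def coprime_commute)
  qed (auto simp: less_def coprime_commute)
  obtain \<alpha> :: "'a \<Rightarrow> nat" where \<alpha>: "inj_on \<alpha> (carrier G)" "\<And>x. 0 < \<alpha> x"
    "\<And>x y. x \<in> carrier G \<Longrightarrow> y \<in> carrier G \<Longrightarrow> \<alpha> x dvd \<alpha> y \<longleftrightarrow> x = y \<or> less x y"
  proof (rule strict_order_embeds_in_divisibility[OF fin, of less])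
    show "\<not> less x x" for x
      by (simp add: less_def)
    show "less x z" if "x \<in> carrier G" "y \<in> carrier G" "z \<in> carrier G" "less x y" "less y z" for x y z
      using that by (rule trans)
  qed (rule that)
  show ?thesis
    unfolding divisor_graph_def
  proof (intro conjI exI[of _ \<alpha>] ballI impI)
    fix x y
    assume "x \<in> pverts (coprime_graph G)" "y \<in> pverts (coprime_graph G)" and ne: "x \<noteq> y"
    then have V: "x \<in> carrier G" "y \<in> carrier G"
      by (auto simp: coprime_graph_def)
    show "(x, y) \<in> parcs (coprime_graph G) \<longleftrightarrow> \<alpha> x dvd \<alpha> y \<or> \<alpha> y dvd \<alpha> x"
      using V ne comparable[OF V] \<alpha>(3)[OF V] \<alpha>(3)[OF V(2,1)]
      by (auto simp: coprime_graph_def coprime_iff_gcd_eq_1)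
  qed (use \<alpha> coprime_graph_simple in \<open>auto simp: coprime_graph_def\<close>)
qed


section \<open>Forcing in the coprime graph\<close>

text \<open>A sufficient condition, for distinct primes \<open>a\<close>, \<open>b\<close>, \<open>c\<close> in the set \<open>N\<close> of element orders
  of a group, that the edges from \<open>a\<close> to \<open>b\<close> and to \<open>c\<close> have the same direction at \<open>a\<close> in every
  transitive orientation: forcing through \<open>b * c\<close> or through \<open>b * d\<close>, \<open>d\<close> and \<open>c * d\<close>. One intermediate
  prime is enough for a direct product.\<close>

definition linked_avoiding :: "nat set \<Rightarrow> nat \<Rightarrow> nat \<Rightarrow> nat \<Rightarrow> bool" where
  "linked_avoiding N a b c \<longleftrightarrow>
    b * c \<in> N \<or> (\<exists>d. prime d \<and> d \<notin> {a, b, c} \<and> b * d \<in> N \<and> c * d \<in> N)"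

definition linked_triple_free :: "nat set \<Rightarrow> nat set \<Rightarrow> bool" where
  "linked_triple_free N U \<longleftrightarrow> (\<forall>a\<in>U. \<forall>b\<in>U. \<forall>c\<in>U. a \<noteq> b \<longrightarrow> a \<noteq> c \<longrightarrow> b \<noteq> c \<longrightarrow>
    \<not> (linked_avoiding N a b c \<and> linked_avoiding N b a c \<and> linked_avoiding N c a b))"

text \<open>The forcing behind this: let \<open>x\<close> be adjacent to \<open>y\<close> and \<open>z\<close>, while \<open>y\<close> and \<open>z\<close> are not
  adjacent. Then the label of \<open>x\<close> divides the label of \<open>y\<close> if and only if it divides that of \<open>z\<close>,
  for otherwise the label of \<open>x\<close> would lie between the other two, making \<open>y\<close> and \<open>z\<close> adjacent.
  An element of order \<open>m * n\<close> is not adjacent to elements of order \<open>m\<close> or \<open>n\<close> and passes this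
  from one to the other. If all three primes of a triple were linked, each of the three pairwise
  adjacent vertices would be a source or a sink among them, and two of the same kind cannot be
  adjacent.\<close>

lemma divisor_graph_linked_triple_free:
  assumes "group G" and fin: "finite (carrier G)" and div: "divisor_graph (coprime_graph G)"
    and primes: "\<And>p. p \<in> U \<Longrightarrow> prime p" and U: "U \<subseteq> element_orders G"
  shows "linked_triple_free (element_orders G) U"
proof -
  interpret group G by fact
  let ?N = "element_orders G"
  obtain \<alpha> :: "'a \<Rightarrow> nat" where inj: "inj_on \<alpha> (carrier G)"
    and adj: "\<And>x y. x \<in> carrier G \<Longrightarrow> y \<in> carrier G \<Longrightarrow> x \<noteq> y \<Longrightarrow>
      coprime (ord x) (ord y) \<longleftrightarrow> \<alpha> x dvd \<alpha> y \<or> \<alpha> y dvd \<alpha> x"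
    using div unfolding divisor_graph_def coprime_graph_def
    by (auto simp: coprime_iff_gcd_eq_1)
  \<comment> \<open>Elements of equal order have the same neighbours, so one representative for each order suffices.\<close>
  define X where "X n = (SOME x. x \<in> carrier G \<and> ord x = n)" for n
  have X: "X n \<in> carrier G" "ord (X n) = n" if "n \<in> ?N" for n
  proof -
    have "\<exists>x. x \<in> carrier G \<and> ord x = n"
      using that by (auto simp: element_orders_iff)
    then have "X n \<in> carrier G \<and> ord (X n) = n"
      unfolding X_def by (rule someI_ex)
    then show "X n \<in> carrier G" "ord (X n) = n" by auto
  qed
  define \<beta> where "\<beta> n = \<alpha> (X n)" for n
  have adjN: "coprime m n \<longleftrightarrow> \<beta> m dvd \<beta> n \<or> \<beta> n dvd \<beta> m"
    if "m \<in> ?N" "n \<in> ?N" "m \<noteq> n" for m n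
  proof -
    have "X m \<noteq> X n"
      using X(2) that by metis
    then show ?thesis
      using adj[of "X m" "X n"] X[OF that(1)] X[OF that(2)] by (simp add: \<beta>_def)
  qed
  have injN: "\<beta> m \<noteq> \<beta> n" if "m \<in> ?N" "n \<in> ?N" "m \<noteq> n" for m n
    using inj X[OF that(1)] X[OF that(2)] that(3) unfolding \<beta>_def by (metis inj_onD)
  have same_side: "\<beta> k dvd \<beta> m \<longleftrightarrow> \<beta> k dvd \<beta> n"
    if "k \<in> ?N" "m \<in> ?N" "n \<in> ?N" "coprime k m" "coprime k n" "\<not> coprime m n" for k m n
  proof (cases "m = n")
    case False
    have "k \<noteq> 1"
      using that(1) by (simp add: element_orders_iff)
    then have "k \<noteq> m" "k \<noteq> n"
      using that(4,5) by auto
    with that False show ?thesis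
      using adjN[of k m] adjN[of k n] adjN[of m n] dvd_trans by blast
  qed simp
  have pair: "\<beta> k dvd \<beta> m \<longleftrightarrow> \<beta> k dvd \<beta> n"
    if "prime k" "prime m" "prime n" "k \<in> ?N" "m \<in> ?N" "n \<in> ?N" "m * n \<in> ?N" "k \<noteq> m" "k \<noteq> n" for k m n
  proof -
    have co: "coprime k m" "coprime k n" "coprime k (m * n)"
      using that primes_coprime by auto
    have "\<not> coprime m (m * n)" "\<not> coprime (m * n) n"
      using that(2,3) by (auto simp: coprime_iff_gcd_eq_1)
    then have "\<beta> k dvd \<beta> m \<longleftrightarrow> \<beta> k dvd \<beta> (m * n)" "\<beta> k dvd \<beta> (m * n) \<longleftrightarrow> \<beta> k dvd \<beta> n"
      using same_side[OF that(4,5,7) co(1,3)] same_side[OF that(4,7,6) co(3,2)] by blast+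
    then show ?thesis by simp
  qed
  have divN: "d \<in> ?N" if "b * d \<in> ?N" "prime d" for b d
  proof -
    obtain x where "x \<in> carrier G" "ord x = b * d"
      using \<open>b * d \<in> ?N\<close> by (auto simp: element_orders_iff)
    moreover have "d \<noteq> 1"
      using \<open>prime d\<close> by auto
    ultimately show ?thesis
      using element_orders_divisor[OF fin, of x d] by simp
  qed
  have forced: "\<beta> k dvd \<beta> m \<longleftrightarrow> \<beta> k dvd \<beta> n"
    if "linked_avoiding ?N k m n" "prime k" "prime m" "prime n" "k \<in> ?N" "m \<in> ?N" "n \<in> ?N" "k \<noteq> m" "k \<noteq> n"
    for k m n
    using that(1) unfolding linked_avoiding_def
  proof (elim disjE exE conjE)
    assume "m * n \<in> ?N"
    then show ?thesis using pair that by blast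
  next
    fix d
    assume d: "prime d" "d \<notin> {k, m, n}" "m * d \<in> ?N" "n * d \<in> ?N"
    then have "d \<in> ?N" "k \<noteq> d" using divN by auto
    then show ?thesis using pair[of k m d] pair[of k n d] d that by blast
  qed
  show ?thesis
    unfolding linked_triple_free_def
  proof (intro ballI impI notI, elim conjE)
    fix a b c
    assume abc: "a \<in> U" "b \<in> U" "c \<in> U" and ne: "a \<noteq> b" "a \<noteq> c" "b \<noteq> c"
      and linked: "linked_avoiding ?N a b c" "linked_avoiding ?N b a c" "linked_avoiding ?N c a b"
    have mem: "a \<in> ?N" "b \<in> ?N" "c \<in> ?N"
      using abc U by blast+
    note pr = primes[OF abc(1)] primes[OF abc(2)] primes[OF abc(3)]
    have "\<beta> a dvd \<beta> b \<longleftrightarrow> \<beta> a dvd \<beta> c" "\<beta> b dvd \<beta> a \<longleftrightarrow> \<beta> b dvd \<beta> c" "\<beta> c dvd \<beta> a \<longleftrightarrow> \<beta> c dvd \<beta> b"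
      using forced[OF linked(1)] forced[OF linked(2)] forced[OF linked(3)] pr ne mem by auto
    moreover have "\<beta> a dvd \<beta> b \<or> \<beta> b dvd \<beta> a" "\<beta> a dvd \<beta> c \<or> \<beta> c dvd \<beta> a" "\<beta> b dvd \<beta> c \<or> \<beta> c dvd \<beta> b"
      using adjN[of a b] adjN[of a c] adjN[of b c] mem pr ne primes_coprime by auto
    ultimately show False
      using injN[of a b] injN[of a c] injN[of b c] mem ne dvd_antisym by metis
  qed
qed


section \<open>The two conditions\<close>

lemma prime_not_in_finite:
  assumes "finite A"
  obtains q :: nat where "prime q" "q \<notin> A"
proof -
  have "\<not> {q. prime q} \<subseteq> A"
    using assms primes_infinite finite_subset by blast
  then show ?thesis
    using that by blast
qed

text \<open>If \<open>b\<close> and \<open>c\<close> both lie only in \<open>A\<close>, a member \<open>d\<close> of \<open>B\<close> other than \<open>a\<close> is automatically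
  different from both and links them; this is where each set must contain more than \<open>a\<close>.\<close>

lemma mixed_products_link:
  assumes mixed: "\<And>a b. a \<in> A \<Longrightarrow> b \<in> B \<Longrightarrow> a \<noteq> b \<Longrightarrow> a * b \<in> N"
    and primes: "\<And>p. p \<in> A \<union> B \<Longrightarrow> prime p"
    and big: "\<not> A \<subseteq> {a}" "\<not> B \<subseteq> {a}"
    and bc: "b \<in> A \<union> B" "c \<in> A \<union> B" "b \<noteq> c"
  shows "linked_avoiding N a b c"
proof (cases "b \<in> A \<and> c \<in> B \<or> b \<in> B \<and> c \<in> A")
  case True
  then have "b * c \<in> N"
    using mixed[of b c] mixed[of c b] bc(3) by (auto simp: mult.commute)
  then show ?thesis
    by (simp add: linked_avoiding_def)
next
  case False
  then consider "b \<in> A - B" "c \<in> A - B" | "b \<in> B - A" "c \<in> B - A"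
    using bc by blast
  then show ?thesis
  proof cases
    case 1
    obtain d where "d \<in> B" "d \<noteq> a" using big(2) by blast
    with 1 have "d \<notin> {a, b, c}" "b * d \<in> N" "c * d \<in> N" "prime d"
      using mixed primes by auto
    then show ?thesis
      unfolding linked_avoiding_def by blast
  next
    case 2
    obtain d where "d \<in> A" "d \<noteq> a" using big(1) by blast
    with 2 have "d \<notin> {a, b, c}" "b * d \<in> N" "c * d \<in> N" "prime d"
      using mixed[of d b] mixed[of d c] primes by (auto simp: mult.commute)
    then show ?thesis
      unfolding linked_avoiding_def by blast
  qed
qed

lemma no_three_distinct_elements:
  assumes "U \<noteq> {}" "\<And>p. U \<noteq> {p}"
    and "\<And>a b c. a \<in> U \<Longrightarrow> b \<in> U \<Longrightarrow> c \<in> U \<Longrightarrow> a \<noteq> b \<Longrightarrow> a \<noteq> c \<Longrightarrow> b \<noteq> c \<Longrightarrow> False"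
  obtains p q where "p \<noteq> q" "U = {p, q}"
proof -
  obtain p where p: "p \<in> U" using assms(1) by blast
  with assms(2)[of p] obtain q where "q \<in> U" "p \<noteq> q" by blast
  moreover from this p assms(3)[of p q] have "U \<subseteq> {p, q}" by blast
  ultimately show ?thesis using p that[of p q] by blast
qed

lemma prime_sets_of_unlinked_factors:
  fixes A B N :: "nat set"
  assumes primes: "\<And>p. p \<in> A \<union> B \<Longrightarrow> prime p" and "A \<noteq> {}" "B \<noteq> {}"
    and mixed: "\<And>a b. a \<in> A \<Longrightarrow> b \<in> B \<Longrightarrow> a \<noteq> b \<Longrightarrow> a * b \<in> N"
    and free: "linked_triple_free N (A \<union> B)"
    and not_single: "\<And>p. A \<noteq> {p}" "\<And>p. B \<noteq> {p}"
  obtains p q where "p \<noteq> q" "A = {p, q}" "B = {p, q}"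
proof -
  have big: "\<not> A \<subseteq> {a}" "\<not> B \<subseteq> {a}" for a
    using assms(2,3) not_single by (auto simp: subset_singleton_iff)
  have link: "linked_avoiding N a b c" if "b \<in> A \<union> B" "c \<in> A \<union> B" "b \<noteq> c" for a b c
    using mixed primes big that by (rule mixed_products_link)
  have "A \<union> B \<noteq> {p}" for p
    using big by blast
  moreover have False if "a \<in> A \<union> B" "b \<in> A \<union> B" "c \<in> A \<union> B" "a \<noteq> b" "a \<noteq> c" "b \<noteq> c" for a b c
    using free that link[OF that(2,3,6), of a] link[OF that(1,3,5), of b] link[OF that(1,2,4), of c]
    unfolding linked_triple_free_def by blast
  moreover have "A \<union> B \<noteq> {}"
    using assms(2) by blast
  ultimately obtain p q where pq: "p \<noteq> q" "A \<union> B = {p, q}"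
    using no_three_distinct_elements[of "A \<union> B"] by (metis (no_types))
  then have sub: "A \<subseteq> {p, q}" "B \<subseteq> {p, q}"
    by auto
  have "p \<in> A" "p \<in> B" "q \<in> A" "q \<in> B"
    using sub big[of p] big[of q] by blast+
  with sub have "A = {p, q}" "B = {p, q}"
    by auto
  with pq(1) show ?thesis by (rule that)
qed

text \<open>Three members of \<open>B\<close> other than \<open>p\<close> would be linked through \<open>p\<close>. If \<open>B\<close> has fewer than
  two, arbitrary primes outside \<open>B\<close> complete the triple, which is why the conclusion constrains
  \<open>q * r\<close> only when both lie in \<open>B\<close>.\<close>

lemma primes_beside_unlinked_single_factor:
  fixes B N :: "nat set"
  assumes fin: "finite B" and primes: "\<And>s. s \<in> insert p B \<Longrightarrow> prime s"
    and mixed: "\<And>b. b \<in> B \<Longrightarrow> p \<noteq> b \<Longrightarrow> p * b \<in> N"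
    and free: "linked_triple_free N (insert p B)"
  obtains q r where "prime q" "prime r" "p \<noteq> q" "p \<noteq> r" "q \<noteq> r" "B \<subseteq> {p, q, r}"
    "q \<in> B \<and> r \<in> B \<longrightarrow> q * r \<notin> N"
proof -
  have mixed': "b * p \<in> N" if "b \<in> B" "p \<noteq> b" for b
    using mixed[OF that] by (simp add: mult.commute)
  have link: "linked_avoiding N a b c" if "b \<in> B - {p}" "c \<in> B - {p}" "a \<noteq> p" for a b c
    unfolding linked_avoiding_def using that primes[of p] mixed'[of b] mixed'[of c] by auto
  have three: False if "a \<in> B - {p}" "b \<in> B - {p}" "c \<in> B - {p}" "a \<noteq> b" "a \<noteq> c" "b \<noteq> c" for a b c
    using free that link[of b c a] link[of a c b] link[of a b c]
    unfolding linked_triple_free_def by blast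
  show ?thesis
  proof (cases "\<exists>q. B - {p} \<subseteq> {q}")
    case True
    then obtain q' where q': "B - {p} \<subseteq> {q'}" by blast
    obtain q where q: "prime q" "p \<noteq> q" "B \<subseteq> {p, q}"
    proof (cases "B - {p} = {}")
      case True
      obtain q where "prime q" "q \<notin> {p}"
        using prime_not_in_finite[of "{p}"] by blast
      with True show ?thesis using that[of q] by blast
    next
      case False
      with q' have "q' \<in> B" "q' \<noteq> p" by blast+
      with q' primes show ?thesis using that[of q'] by blast
    qed
    obtain r where "prime r" "r \<notin> insert p (insert q B)"
      using prime_not_in_finite[of "insert p (insert q B)"] fin by blast
    with q show ?thesis using that[of q r] by blast
  next
    case False
    then obtain q r where qr: "q \<noteq> r" "B - {p} = {q, r}"
      using no_three_distinct_elements[of "B - {p}"] three by (metis empty_subsetI order_refl)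
    then have B: "q \<in> B" "r \<in> B" "q \<noteq> p" "r \<noteq> p" "B \<subseteq> {p, q, r}" by blast+
    have "q * r \<notin> N"
    proof
      assume "q * r \<in> N"
      then have "linked_avoiding N p q r" "linked_avoiding N q p r" "linked_avoiding N r p q"
        using mixed B by (auto simp: linked_avoiding_def)
      with free[unfolded linked_triple_free_def, rule_format, of p q r] B qr(1) show False
        by simp
    qed
    with B qr(1) primes show ?thesis using that[of q r] by blast
  qed
qed

text \<open>The set \<open>N\<close> stands for the element orders of the direct product. Keeping it abstract lets the
  lemma serve for both \<open>H \<times> K\<close> and \<open>K \<times> H\<close>.\<close>

lemma condition_bI:
  assumes "group K" "finite (carrier K)" and H: "order_primes H = {p}"
    and sub: "element_orders K \<subseteq> N"
    and mixed: "\<And>b. b \<in> order_primes K \<Longrightarrow> p \<noteq> b \<Longrightarrow> p * b \<in> N"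
    and free: "linked_triple_free N (insert p (order_primes K))"
  shows "condition_b H K"
proof -
  interpret K: group K by fact
  have pos: "order K > 0"
    using assms(2) K.order_gt_0_iff_finite by blast
  have fin: "finite (order_primes K)"
    by (rule finite_subset[of _ "{..order K}"])
      (use pos dvd_imp_le in \<open>auto simp: order_primes_def\<close>)
  have primes: "prime s" if "s \<in> insert p (order_primes K)" for s
    using that H by (auto simp: order_primes_def)
  obtain q r where qr: "prime q" "prime r" "p \<noteq> q" "p \<noteq> r" "q \<noteq> r" "order_primes K \<subseteq> {p, q, r}"
    "q \<in> order_primes K \<and> r \<in> order_primes K \<longrightarrow> q * r \<notin> N"
    by (rule primes_beside_unlinked_single_factor[of "order_primes K" p N, OF fin primes mixed free])
  have "q * r \<notin> element_orders K"
  proof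
    assume *: "q * r \<in> element_orders K"
    then obtain y where "y \<in> carrier K" "K.ord y = q * r"
      by (auto simp: K.element_orders_iff)
    then have "q \<in> order_primes K" "r \<in> order_primes K"
      using qr(1,2) by (auto intro!: K.prime_dvd_ord_order_primes[of y])
    with qr(7) sub * show False by blast
  qed
  with qr primes[of p] H show ?thesis
    unfolding condition_b_def by blast
qed

lemma conditions_of_divisor_graph:
  assumes H: "group H" "finite (carrier H)" "carrier H \<noteq> {\<one>\<^bsub>H\<^esub>}"
    and K: "group K" "finite (carrier K)" "carrier K \<noteq> {\<one>\<^bsub>K\<^esub>}"
    and div: "divisor_graph (coprime_graph (H \<times>\<times> K))"
  shows "condition_a H K \<or> condition_b H K \<or> condition_b K H"
proof -
  let ?A = "order_primes H" and ?B = "order_primes K" and ?N = "element_orders (H \<times>\<times> K)"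
  have G: "group (H \<times>\<times> K)" "finite (carrier (H \<times>\<times> K))"
    using H K by (auto intro: DirProd_group)
  have primes: "prime s" if "s \<in> ?A \<union> ?B" for s
    using that by (auto simp: order_primes_def)
  note A = group.order_primes_subset_element_orders[OF H(1,2)]
  note B = group.order_primes_subset_element_orders[OF K(1,2)]
  note subN = element_orders_subset_DirProd[OF H(1) K(1)]
  have mixed: "a * b \<in> ?N" if "a \<in> ?A" "b \<in> ?B" "a \<noteq> b" for a b
    using element_orders_DirProd_mult[OF H(1) K(1), of a b] A B that primes primes_coprime by blast
  then have mixed': "b * a \<in> ?N" if "a \<in> ?A" "b \<in> ?B" "b \<noteq> a" for a b
    using that by (metis mult.commute)
  have free: "linked_triple_free ?N (?A \<union> ?B)"
    using G div primes
  proof (rule divisor_graph_linked_triple_free)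
    show "?A \<union> ?B \<subseteq> ?N"
      using A B subN by blast
  qed
  consider p where "?A = {p}" | p where "?B = {p}" | "\<And>p. ?A \<noteq> {p}" "\<And>p. ?B \<noteq> {p}"
    by blast
  then show ?thesis
  proof cases
    case 1
    have "condition_b H K"
      by (rule condition_bI[OF K(1,2) 1 subN(2)]) (use mixed free 1 in \<open>auto simp: Un_commute\<close>)
    then show ?thesis by blast
  next
    case 2
    have "condition_b K H"
      by (rule condition_bI[OF H(1,2) 2 subN(1)]) (use mixed' free 2 in \<open>auto simp: Un_commute\<close>)
    then show ?thesis by blast
  next
    case 3
    obtain p q where "p \<noteq> q" "?A = {p, q}" "?B = {p, q}"
      by (rule prime_sets_of_unlinked_factors[of ?A ?B ?N, OF primes
        group.order_primes_nonempty[OF H] group.order_primes_nonempty[OF K] mixed free 3])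
    moreover from this have "prime p" "prime q"
      using primes by auto
    ultimately show ?thesis
      unfolding condition_a_def by blast
  qed
qed

text \<open>If \<open>p\<close> does not divide the order of \<open>(x, y)\<close>, then \<open>x\<close> is trivial, and a power of \<open>y\<close> has
  order \<open>q * r\<close>.\<close>

lemma single_prime_factor_carries_prime:
  assumes "group H" "finite (carrier H)" "group K" "finite (carrier K)"
    and H: "order_primes H = {p}" and qr: "prime q" "prime r" "q \<noteq> r" "q * r \<notin> element_orders K"
    and xy: "x \<in> carrier H" "y \<in> carrier K"
    and dvd: "q dvd lcm (group.ord H x) (group.ord K y)" "r dvd lcm (group.ord H x) (group.ord K y)"
  shows "p dvd lcm (group.ord H x) (group.ord K y)"
proof (rule ccontr)
  interpret H: group H by fact
  interpret K: group K by fact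
  assume no_p: "\<not> ?thesis"
  have "H.ord x = 1"
  proof (rule ccontr)
    assume "H.ord x \<noteq> 1"
    then obtain s where "prime s" "s dvd H.ord x"
      using prime_factor_nat by blast
    then have "s \<in> order_primes H"
      using H.prime_dvd_ord_order_primes[OF xy(1)] by simp
    with H \<open>s dvd H.ord x\<close> have "p dvd H.ord x" by simp
    with no_p show False by auto
  qed
  with dvd have "q dvd K.ord y" "r dvd K.ord y" by auto
  then have "q * r dvd K.ord y"
    using qr primes_coprime by (intro divides_mult) auto
  then show False
    using K.element_orders_divisor[OF assms(4) xy(2), of "q * r"] qr by auto
qed

theorem theorem8p1:
  fixes H :: "('a, 'm) monoid_scheme" and K :: "('b, 'n) monoid_scheme"
  assumes "group H" and "finite (carrier H)" and "carrier H \<noteq> {\<one>\<^bsub>H\<^esub>}"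
    and "group K" and "finite (carrier K)" and "carrier K \<noteq> {\<one>\<^bsub>K\<^esub>}"
  shows "divisor_graph (coprime_graph (H \<times>\<times> K)) \<longleftrightarrow>
    condition_a H K \<or> condition_b H K \<or> condition_b K H"
proof
  assume "divisor_graph (coprime_graph (H \<times>\<times> K))"
  with assms show "condition_a H K \<or> condition_b H K \<or> condition_b K H"
    by (rule conditions_of_divisor_graph)
next
  interpret H: group H by fact
  interpret K: group K by fact
  have G: "group (H \<times>\<times> K)" "finite (carrier (H \<times>\<times> K))"
    using assms by (auto intro: DirProd_group)
  have criterion: "divisor_graph (coprime_graph (H \<times>\<times> K))"
    if pqr: "prime p" "prime q" "prime r" and sub: "order_primes H \<union> order_primes K \<subseteq> {p, q, r}"
      and qr: "\<And>x y. x \<in> carrier H \<Longrightarrow> y \<in> carrier K \<Longrightarrow> q dvd lcm (H.ord x) (K.ord y) \<Longrightarrow>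
        r dvd lcm (H.ord x) (K.ord y) \<Longrightarrow> p dvd lcm (H.ord x) (K.ord y)" for p q r
  proof (rule group.divisor_graph_coprime_graphI[OF G pqr])
    fix z s
    assume z: "z \<in> carrier (H \<times>\<times> K)" and s: "prime s" "s dvd group.ord (H \<times>\<times> K) z"
    obtain x y where xy: "z = (x, y)" "x \<in> carrier H" "y \<in> carrier K"
      using z by auto
    then have "s dvd H.ord x * K.ord y"
      using s(2) assms by (auto simp: ord_DirProd intro: dvd_trans)
    then have "s dvd H.ord x \<or> s dvd K.ord y"
      using s(1) by (simp add: prime_dvd_mult_iff)
    then have "s \<in> order_primes H \<union> order_primes K"
      using H.prime_dvd_ord_order_primes[OF xy(2) s(1)] K.prime_dvd_ord_order_primes[OF xy(3) s(1)] by blast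
    with sub show "s \<in> {p, q, r}" ..
  next
    fix z
    assume "z \<in> carrier (H \<times>\<times> K)" "q dvd group.ord (H \<times>\<times> K) z" "r dvd group.ord (H \<times>\<times> K) z"
    then show "p dvd group.ord (H \<times>\<times> K) z"
      using qr assms by (auto simp: ord_DirProd)
  qed
  assume "condition_a H K \<or> condition_b H K \<or> condition_b K H"
  then consider "condition_a H K" | "condition_b H K" | "condition_b K H" by blast
  then show "divisor_graph (coprime_graph (H \<times>\<times> K))"
  proof cases
    case 1
    then obtain p q where pq: "prime p" "prime q" "order_primes H = {p, q}" "order_primes K = {p, q}"
      unfolding condition_a_def by blast
    \<comment> \<open>With \<open>q\<close> in place of \<open>r\<close> and as the exempting prime, the hypothesis on products is trivial.\<close>
    then show ?thesis
      by (intro criterion[of q p q]) auto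
  next
    case 2
    then obtain p q r where "prime p" "prime q" "prime r" "q \<noteq> r" "order_primes H = {p}"
      "order_primes K \<subseteq> {p, q, r}" "q * r \<notin> element_orders K"
      unfolding condition_b_def by blast
    with assms show ?thesis
      using single_prime_factor_carries_prime[of H K p q r] by (intro criterion[of p q r]) auto
  next
    case 3
    then obtain p q r where "prime p" "prime q" "prime r" "q \<noteq> r" "order_primes K = {p}"
      "order_primes H \<subseteq> {p, q, r}" "q * r \<notin> element_orders H"
      unfolding condition_b_def by blast
    with assms show ?thesis
      using single_prime_factor_carries_prime[of K H p q r]
      by (intro criterion[of p q r]) (auto simp: lcm.commute)
  qed
qed

end
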